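(* Assume that, as $p\to\infty$ through the odd primes, $\sup_{j\in\mathbb{F}_p^\times}\Lambda_{S_j}(\vartheta)\to\Lambda_\flat(\vartheta)$ uniformly for $0\le\vartheta\le4$, where $$\Lambda_\flat(\vartheta)=\begin{cases}0,&0\le\vartheta<2,\\ \frac{\vartheta-2}{2},&2\le\vartheta\le3,\\ \frac12,&3<\vartheta\le4.\end{cases}$$ Let $\varepsilon>0$. Then for any odd prime $p$ and any subsets $E,F\subseteq\mathbb{F}_p^4$ with $|F|\le|E|$ and $|E||F|\ge p^{4+\varepsilon}$, there exists $F'\subseteq F$ such that $|F'|=(1+o_\varepsilon(1))|F|$ and $|\Delta_y(E)|=(1+o_\varepsilon(1))p$ uniformly for every $y\in F'$.
   Context: The hypothesis is the paper's Localized Spherical Restriction/Extension Conjecture. For an odd prime $p$, let $\chi(y)=e^{2\pi i y/p}$ on $\mathbb{F}_p$, $Q_4(x)=x_1^2+\dots+x_4^2$, and for $j\in\mathbb{F}_p^\times$ let $S_j=\{x\in\mathbb{F}_p^4:Q_4(x)=j\}$ with uniform probability measure $d\sigma_j$, so $\|f\|_{L^2(S_j,d\sigma_j)}=\big(\frac1{|S_j|}\sum_{\xi\in S_j}|f(\xi)|^2\big)^{1/2}$. Let $(f\,d\sigma_j)^\vee(x)=\frac1{|S_j|}\sum_{y\in S_j}f(y)\chi(y\cdot x)$, and let $L^2(E)$ use counting measure. For $0\le\vartheta\le4$, $\Lambda_{S_j}(\vartheta)$ is the infimum of all $\lambda\ge0$ such that for every $E\subseteq\mathbb{F}_p^4$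 with $1\le|E|\le p^\vartheta$ and every $f:S_j\to\mathbb{C}$, $\|(f\,d\sigma_j)^\vee\|_{L^2(E)}\le p^\lambda\|f\|_{L^2(S_j,d\sigma_j)}$. For $y\in\mathbb{F}_p^4$, $\Delta_y(E)=\{Q_4(x-y):x\in E\}\subseteq\mathbb{F}_p$. The notation $o_\varepsilon(1)$ denotes a quantity that may depend on $\varepsilon$ and $p$ and tends to $0$ as $p\to\infty$ for each fixed $\varepsilon$; the convergence is uniform over all sets $E,F$ satisfying the hypotheses and over $y\in F'$. *)

theory Defs
  imports "HOL-Analysis.Analysis" "HOL-Computational_Algebra.Primes"
begin

text \<open>
  Since the prime \<open>p\<close> varies inside the statement, the field with \<open>p\<close> elements is modelled by the
  canonical residues \<open>{0..<p}\<close> in \<^typ>\<open>int\<close>; arithmetic is done in \<^typ>\<open>int\<close> and reduced modulo \<open>p\<close>.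
\<close>

definition Fp4 :: "nat \<Rightarrow> (int ^ 4) set" where
  "Fp4 p = {x. \<forall>i. x $ i \<in> {0..<int p}}"

definition Q4 :: "nat \<Rightarrow> int ^ 4 \<Rightarrow> int" where
  "Q4 p x = (\<Sum>i\<in>UNIV. (x $ i)\<^sup>2) mod int p"

text \<open>The additive character; as a function on \<^typ>\<open>int\<close> it is \<open>p\<close>-periodic.\<close>

definition chi :: "nat \<Rightarrow> int \<Rightarrow> complex" where
  "chi p y = exp (2 * of_real pi * \<i> * of_int y / of_nat p)"

definition dot4 :: "int ^ 4 \<Rightarrow> int ^ 4 \<Rightarrow> int" where
  "dot4 x y = (\<Sum>i\<in>UNIV. x $ i * y $ i)"

definition Sph :: "nat \<Rightarrow> int \<Rightarrow> (int ^ 4) set" where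
  "Sph p j = {x \<in> Fp4 p. Q4 p x = j}"

text \<open>
  A function on the sphere is represented by a function on all of \<^typ>\<open>int ^ 4\<close>, of which only the
  values on the sphere are used.
\<close>

definition sphere_L2_norm :: "nat \<Rightarrow> int \<Rightarrow> (int ^ 4 \<Rightarrow> complex) \<Rightarrow> real" where
  "sphere_L2_norm p j f =
     sqrt ((1 / real (card (Sph p j))) * (\<Sum>\<xi>\<in>Sph p j. (cmod (f \<xi>))\<^sup>2))"

definition extension_op :: "nat \<Rightarrow> int \<Rightarrow> (int ^ 4 \<Rightarrow> complex) \<Rightarrow> int ^ 4 \<Rightarrow> complex" where
  "extension_op p j f x =
     (1 / of_nat (card (Sph p j))) * (\<Sum>y\<in>Sph p j. f y * chi p (dot4 y x))"

definition counting_L2_norm :: "(int ^ 4) set \<Rightarrow> (int ^ 4 \<Rightarrow> complex) \<Rightarrow> real" where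
  "counting_L2_norm E g = sqrt (\<Sum>x\<in>E. (cmod (g x))\<^sup>2)"

definition Lambda_sphere :: "nat \<Rightarrow> int \<Rightarrow> real \<Rightarrow> real" where
  "Lambda_sphere p j \<theta> = Inf {l. l \<ge> 0 \<and>
     (\<forall>E f. E \<subseteq> Fp4 p \<longrightarrow> 1 \<le> card E \<longrightarrow> real (card E) \<le> real p powr \<theta> \<longrightarrow>
        counting_L2_norm E (extension_op p j f) \<le> real p powr l * sphere_L2_norm p j f)}"

definition Lambda_flat :: "real \<Rightarrow> real" where
  "Lambda_flat \<theta> = (if \<theta> < 2 then 0 else if \<theta> \<le> 3 then (\<theta> - 2) / 2 else 1 / 2)"

definition pinned_dists :: "nat \<Rightarrow> int ^ 4 \<Rightarrow> (int ^ 4) set \<Rightarrow> int set" where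
  "pinned_dists p y E = (\<lambda>x. Q4 p (x - y)) ` E"

text \<open>The filter expressing that \<open>p\<close> tends to infinity through the odd primes.\<close>

definition odd_primes_at_top :: "nat filter" where
  "odd_primes_at_top = inf at_top (principal {p. prime p \<and> odd p})"

definition localized_restriction_conjecture :: bool where
  "localized_restriction_conjecture \<longleftrightarrow>
     uniform_limit {0..4} (\<lambda>p \<theta>. SUP j\<in>{1..<int p}. Lambda_sphere p j \<theta>)
       Lambda_flat odd_primes_at_top"

end

theory Submission
  imports Defs "HOL-Number_Theory.Cong"
begin

text \<open>
  Fix a pin \<open>y\<close> and let \<open>\<nu>(t)\<close> be the number of \<open>x \<in> E\<close> with \<open>Q4 p (x - y) = t\<close>. A value \<open>t\<close> that
  \<open>y\<close> does not see has \<open>\<nu>(t) = 0\<close>, hence contributes the full \<open>(|E|/p)\<^sup>2\<close> to the variance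
  \<open>V(y) = \<Sum>t \<noteq> 0. (\<nu>(t) - |E|/p)\<^sup>2\<close>. So it is enough that \<open>V(y)\<close> is much smaller than \<open>|E|\<^sup>2/p\<close> for
  most \<open>y \<in> F\<close>, and by Markov's inequality it is enough to bound the average of \<open>V\<close> over \<open>F\<close>
  (lemmas \<open>missing_distances\<close> and \<open>markov_inequality_card\<close>).

  The variance is controlled by restriction to spheres on the Fourier side. Let \<open>A\<^sub>j(y)\<close> be the part
  with frequencies in the sphere \<open>S\<^sub>j\<close> of the Fourier expansion of the indicator of \<open>E\<close>. A quadratic
  Gauss sum over four variables is exactly \<open>p\<^sup>2\<close>, without any dependence on the quadratic character.
  Therefore, for \<open>s \<noteq> 0\<close>, the Fourier coefficient of \<open>\<nu>\<close> at \<open>s\<close> is \<open>1/p\<^sup>2\<close> times the coefficient of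
  \<open>j \<mapsto> A\<^sub>j(y)\<close> at \<open>-1/(4s)\<close>: after removal of the means and of this factor, the two functions have the
  same Fourier coefficients in permuted order. By Parseval they have the same energy, and by inversion
  they agree at 0, which gives the exact identity (lemma \<open>distance_variance\<close>)
  \<open>V(y) = \<Sum>j \<noteq> 0. |A\<^sub>j(y) / p\<^sup>2 - p 1\<^sub>E(y)|\<^sup>2\<close>.
  Leaving out \<open>t = 0\<close> on the left is thus the same as leaving out \<open>j = 0\<close> on the right. This matters
  because the conjecture is about the spheres with \<open>j \<noteq> 0\<close> only, and \<open>j = 0\<close> is the cone.

  Up to the factor \<open>|S\<^sub>j|\<close>, the function \<open>A\<^sub>j\<close> is the extension operator applied to the Fourier transform
  of \<open>E\<close>. The conjecture, applied on the set \<open>F\<close> with \<open>|F| = p\<^sup>\<theta>\<close>, thus gives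
  \<open>\<Sum>y \<in> F. |A\<^sub>j(y)|\<^sup>2 \<le> 2 p\<^sup>3 p powr (2 \<lambda>) \<Sum>\<xi> \<in> S\<^sub>j. |f\<^sub>E(\<xi>)|\<^sup>2\<close> where \<open>f\<^sub>E\<close> is the Fourier
  transform of the indicator of \<open>E\<close> and \<open>\<lambda>\<close> is slightly above \<open>\<Lambda>(\<theta>)\<close>, and
  the sum over \<open>j\<close> is bounded by Plancherel (lemma \<open>sum_distance_defect_le\<close>). What remains is to compare
  \<open>p powr (4 + 2 \<lambda>)\<close> with \<open>|E||F|\<close> on the three ranges of \<open>\<theta>\<close>, which uses \<open>|F| \<le> |E|\<close>
  (lemma \<open>exponent_balance\<close>).
\<close>

section \<open>Fourier analysis on residues modulo p\<close>

lemma chi_add: "chi p (a + b) = chi p a * chi p b"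
  by (simp add: chi_def add_divide_distrib distrib_left exp_add)

lemma chi_0 [simp]: "chi p 0 = 1"
  by (simp add: chi_def)

lemma chi_sum: "finite A \<Longrightarrow> chi p (\<Sum>i\<in>A. f i) = (\<Prod>i\<in>A. chi p (f i))"
  by (induction A rule: finite_induct) (auto simp: chi_add)

lemma norm_chi [simp]: "cmod (chi p a) = 1"
proof -
  have "chi p a = exp (\<i> * of_real (2 * pi * of_int a / of_nat p))"
    by (simp add: chi_def mult_ac)
  then show ?thesis by (metis norm_exp_i_times)
qed

lemma cnj_chi: "cnj (chi p a) = chi p (- a)"
  by (simp add: chi_def exp_cnj)

lemma chi_diff: "chi p (a - b) = chi p a * cnj (chi p b)"
  using chi_add[of p a "- b"] by (simp add: cnj_chi)

lemma chi_eq_1_iff: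
  assumes "p > 0" shows "chi p a = 1 \<longleftrightarrow> int p dvd a"
proof -
  have "chi p a = 1 \<longleftrightarrow> (\<exists>n::int. 2 * pi * of_int a / of_nat p = of_int (2 * n) * pi)"
    unfolding chi_def exp_eq_1 by (simp add: mult_ac)
  also have "\<dots> \<longleftrightarrow> (\<exists>n::int. of_int a = (of_int (int p * n) :: real))"
    using assms by (intro ex_cong1) (auto simp: field_simps)
  also have "\<dots> \<longleftrightarrow> int p dvd a"
    unfolding of_int_eq_iff dvd_def ..
  finally show ?thesis .
qed

lemma chi_cong:
  assumes "p > 0" "[a = b] (mod int p)" shows "chi p a = chi p b"
proof -
  have "chi p (a - b) = 1"
    using assms by (simp add: chi_eq_1_iff cong_iff_dvd_diff)
  then show ?thesis
    using chi_add[of p "a - b" b] by simp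
qed

lemma sum_residues_reindex:
  fixes f :: "int \<Rightarrow> complex"
  assumes "p > 0" "inj_on (\<lambda>t. h t mod int p) {0..<int p}"
    and "\<And>a b. [a = b] (mod int p) \<Longrightarrow> f a = f b"
  shows "(\<Sum>t\<in>{0..<int p}. f (h t)) = (\<Sum>t\<in>{0..<int p}. f t)"
proof -
  have "(\<lambda>t. h t mod int p) ` {0..<int p} = {0..<int p}"
    using assms(1,2) by (intro endo_inj_surj) auto
  then have "(\<Sum>t\<in>{0..<int p}. f t) = (\<Sum>t\<in>{0..<int p}. f (h t mod int p))"
    using assms(2) by (metis (no_types, lifting) sum.reindex_cong)
  also have "\<dots> = (\<Sum>t\<in>{0..<int p}. f (h t))"
    by (intro sum.cong refl assms(3)) (simp add: cong_def)
  finally show ?thesis ..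
qed

lemma sum_residues_shift:
  fixes f :: "int \<Rightarrow> complex"
  assumes "p > 0" "\<And>a b. [a = b] (mod int p) \<Longrightarrow> f a = f b"
  shows "(\<Sum>t\<in>{0..<int p}. f (t + c)) = (\<Sum>t\<in>{0..<int p}. f t)"
proof (rule sum_residues_reindex[OF assms(1) _ assms(2)])
  show "inj_on (\<lambda>t. (t + c) mod int p) {0..<int p}"
    by (rule inj_onI) (metis atLeastLessThan_iff cong_add_rcancel cong_def mod_pos_pos_trivial)
qed

text \<open>Translating the summation variable by 1 multiplies the sum by \<open>chi p a\<close>, so the sum vanishes
  unless that factor is 1.\<close>

lemma chi_orthogonality:
  assumes "p > 0"
  shows "(\<Sum>t\<in>{0..<int p}. chi p (t * a)) = (if int p dvd a then of_nat p else 0)"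
proof (cases "int p dvd a")
  case True
  then have "chi p (t * a) = 1" for t using assms by (simp add: chi_eq_1_iff)
  then show ?thesis using True by simp
next
  case False
  let ?S = "\<Sum>t\<in>{0..<int p}. chi p (t * a)"
  have "?S = (\<Sum>t\<in>{0..<int p}. chi p ((t + 1) * a))"
    by (rule sum_residues_shift[OF assms, symmetric]) (auto intro!: chi_cong assms cong_scalar_right)
  also have "\<dots> = chi p a * ?S"
    by (simp only: distrib_right mult_1_left chi_add sum_distrib_left) (simp add: mult.commute)
  finally have "(1 - chi p a) * ?S = 0" by (simp add: algebra_simps)
  then show ?thesis using False assms by (simp add: chi_eq_1_iff)
qed

definition zfourier :: "nat \<Rightarrow> (int \<Rightarrow> complex) \<Rightarrow> int \<Rightarrow> complex" where
  "zfourier p f s = (\<Sum>t\<in>{0..<int p}. f t * chi p (s * t))"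

text \<open>Fourier inversion at the origin: the only case needed, since it identifies the value at 0 of two
  functions whose coefficients agree up to a permutation.\<close>

lemma sum_zfourier:
  assumes "p > 0"
  shows "(\<Sum>s\<in>{0..<int p}. zfourier p f s) = of_nat p * f 0"
proof -
  have "(\<Sum>s\<in>{0..<int p}. zfourier p f s)
      = (\<Sum>t\<in>{0..<int p}. f t * (\<Sum>s\<in>{0..<int p}. chi p (s * t)))"
    unfolding zfourier_def by (subst sum.swap) (simp add: sum_distrib_left)
  also have "\<dots> = (\<Sum>t\<in>{0..<int p}. if t = 0 then of_nat p * f 0 else 0)"
    by (rule sum.cong) (use assms in \<open>auto simp: chi_orthogonality dest: zdvd_imp_le\<close>)
  also have "\<dots> = of_nat p * f 0" using assms by simp
  finally show ?thesis .
qed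

lemma dvd_diff_residues_iff:
  assumes "t \<in> {0..<int p}" "t' \<in> {0..<int p}"
  shows "int p dvd t - t' \<longleftrightarrow> t = t'"
  using assms by (auto simp: mod_eq_dvd_iff[symmetric])

lemma parseval_residues:
  assumes "p > 0"
  shows "(\<Sum>s\<in>{0..<int p}. (cmod (zfourier p f s))\<^sup>2) = real p * (\<Sum>t\<in>{0..<int p}. (cmod (f t))\<^sup>2)"
proof -
  let ?R = "{0..<int p}"
  have "complex_of_real (\<Sum>s\<in>?R. (cmod (zfourier p f s))\<^sup>2) = (\<Sum>s\<in>?R. zfourier p f s * cnj (zfourier p f s))"
    by (simp add: complex_norm_square del: of_real_power)
  also have "\<dots> = (\<Sum>s\<in>?R. \<Sum>t\<in>?R. \<Sum>t'\<in>?R. f t * cnj (f t') * chi p (s * (t - t')))"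
    unfolding zfourier_def cnj_sum sum_product complex_cnj_mult
    by (intro sum.cong refl) (simp add: chi_diff right_diff_distrib mult_ac)
  also have "\<dots> = (\<Sum>t\<in>?R. \<Sum>t'\<in>?R. \<Sum>s\<in>?R. f t * cnj (f t') * chi p (s * (t - t')))"
    by (rule trans[OF sum.swap], rule sum.cong, rule refl, rule sum.swap)
  also have "\<dots> = (\<Sum>t\<in>?R. \<Sum>t'\<in>?R. if t' = t then of_nat p * (f t * cnj (f t)) else 0)"
    by (intro sum.cong refl, subst sum_distrib_left[symmetric], subst chi_orthogonality[OF assms])
       (auto simp: dvd_diff_residues_iff)
  also have "\<dots> = complex_of_real (real p * (\<Sum>t\<in>?R. (cmod (f t))\<^sup>2))"
    by (simp add: complex_norm_square sum_distrib_left del: of_real_power)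
  finally show ?thesis unfolding of_real_eq_iff .
qed

section \<open>Gauss sums\<close>

definition gauss_sum :: "nat \<Rightarrow> int \<Rightarrow> complex" where
  "gauss_sum p u = (\<Sum>t\<in>{0..<int p}. chi p (u * t\<^sup>2))"

lemma cnj_gauss_sum: "cnj (gauss_sum p u) = gauss_sum p (- u)"
  by (simp add: gauss_sum_def cnj_chi)

lemma odd_prime_dvd_2_mult_iff:
  assumes "prime p" "odd p"
  shows "int p dvd 2 * a \<longleftrightarrow> int p dvd a"
proof -
  have "coprime (int p) 2" using assms by (simp add: coprime_commute)
  then show ?thesis by (simp add: coprime_dvd_mult_right_iff)
qed

lemma norm_gauss_sum:
  assumes "prime p" "odd p" "\<not> int p dvd u"
  shows "gauss_sum p u * cnj (gauss_sum p u) = of_nat p"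
proof -
  let ?R = "{0..<int p}"
  have p: "p > 0" using assms(1) by (simp add: prime_gt_0_nat)
  have prime: "prime (int p)" using assms(1) by simp
  have "gauss_sum p u * cnj (gauss_sum p u) = (\<Sum>b\<in>?R. \<Sum>a\<in>?R. chi p (u * a\<^sup>2 - u * b\<^sup>2))"
    unfolding gauss_sum_def cnj_sum sum_product by (subst sum.swap) (simp add: chi_diff)
  \<comment> \<open>In the variable \<open>h = a - b\<close> the exponent becomes linear in \<open>b\<close>.\<close>
  also have "\<dots> = (\<Sum>b\<in>?R. \<Sum>h\<in>?R. chi p (u * (h + b)\<^sup>2 - u * b\<^sup>2))"
    by (intro sum.cong refl sum_residues_shift[OF p, symmetric] chi_cong p cong_diff cong_mult cong_pow cong_refl)
  also have "\<dots> = (\<Sum>b\<in>?R. \<Sum>h\<in>?R. chi p (u * h\<^sup>2) * chi p (b * (2 * (u * h))))"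
    unfolding chi_add[symmetric] by (simp add: power2_eq_square algebra_simps)
  also have "\<dots> = (\<Sum>h\<in>?R. chi p (u * h\<^sup>2) * (\<Sum>b\<in>?R. chi p (b * (2 * (u * h)))))"
    by (subst sum.swap) (simp add: sum_distrib_left)
  also have "\<dots> = (\<Sum>h\<in>?R. if h = 0 then of_nat p else 0)"
  proof (intro sum.cong refl)
    fix h assume h: "h \<in> ?R"
    have "int p dvd 2 * (u * h) \<longleftrightarrow> int p dvd h"
      unfolding odd_prime_dvd_2_mult_iff[OF assms(1,2)] using assms(3) prime
      by (simp add: prime_dvd_mult_iff)
    also have "\<dots> \<longleftrightarrow> h = 0" using h by (auto dest: zdvd_imp_le)
    finally have "int p dvd 2 * (u * h) \<longleftrightarrow> h = 0" .
    then show "chi p (u * h\<^sup>2) * (\<Sum>b\<in>?R. chi p (b * (2 * (u * h)))) = (if h = 0 then of_nat p else 0)"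
      using p by (simp add: chi_orthogonality)
  qed
  also have "\<dots> = of_nat p" using p by simp
  finally show ?thesis .
qed

text \<open>By pigeonhole: the squares and the numbers \<open>-1 - d\<^sup>2\<close> each take \<open>(p + 1)/2\<close> values, as \<open>c\<close> and \<open>d\<close>
  run from 0 to \<open>(p - 1)/2\<close>, and only \<open>p\<close> residues are available.\<close>

lemma minus_one_sum_two_squares:
  assumes "prime p" "odd p"
  shows "\<exists>c d::int. [c\<^sup>2 + d\<^sup>2 = -1] (mod int p)"
proof (rule ccontr)
  assume no: "\<not> ?thesis"
  define H where "H = {0..(int p - 1) div 2}"
  let ?sq = "\<lambda>c::int. c\<^sup>2 mod int p" and ?co = "\<lambda>d::int. (- 1 - d\<^sup>2) mod int p"
  have p: "p > 0" using assms(1) by (simp add: prime_gt_0_nat)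
  have prime: "prime (int p)" using assms(1) by simp
  have inj: "a = b" if "a \<in> H" "b \<in> H" "int p dvd a\<^sup>2 - b\<^sup>2" for a b
  proof -
    have "int p dvd (a - b) * (a + b)" using that(3) by (simp add: power2_eq_square algebra_simps)
    then have "int p dvd a - b \<or> int p dvd a + b" using prime by (simp add: prime_dvd_mult_iff)
    then show ?thesis
    proof
      assume "int p dvd a - b"
      then show ?thesis using that(1,2) dvd_diff_residues_iff[of a p b] p by (auto simp: H_def)
    next
      assume "int p dvd a + b"
      moreover have "a + b < int p" "0 \<le> a" "0 \<le> b" using that(1,2) p by (auto simp: H_def)
      ultimately have "a + b = 0" using zdvd_imp_le[of "int p" "a + b"] by linarith
      then show ?thesis using \<open>0 \<le> a\<close> \<open>0 \<le> b\<close> by linarith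
    qed
  qed
  have "inj_on ?sq H" by (rule inj_onI) (simp add: inj mod_eq_dvd_iff)
  moreover have "inj_on ?co H"
    by (rule inj_onI, rule inj) (auto simp: mod_eq_dvd_iff dvd_diff_commute)
  moreover have "?sq ` H \<inter> ?co ` H = {}"
  proof (rule ccontr)
    assume "?sq ` H \<inter> ?co ` H \<noteq> {}"
    then obtain c d where "[c\<^sup>2 = - 1 - d\<^sup>2] (mod int p)" by (auto simp: cong_def)
    then have "[c\<^sup>2 + d\<^sup>2 = -1] (mod int p)" by (simp add: cong_iff_dvd_diff algebra_simps)
    then show False using no by blast
  qed
  ultimately have "card (?sq ` H \<union> ?co ` H) = 2 * card H"
    by (subst card_Un_disjoint) (auto simp: card_image H_def)
  moreover have "card (?sq ` H \<union> ?co ` H) \<le> card {0..<int p}"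
    using p by (intro card_mono) auto
  moreover have "2 * card H = p + 1" using assms(2) by (auto simp: H_def elim!: oddE)
  ultimately show False by simp
qed

text \<open>
  The square of the Gauss sum is the sum of \<open>chi p (u * (a\<^sup>2 + b\<^sup>2))\<close> over pairs. With
  \<open>c\<^sup>2 + d\<^sup>2 = -1\<close>, multiplication of \<open>a + b i\<close> by \<open>c + d i\<close> permutes the pairs and turns the norm
  form \<open>a\<^sup>2 + b\<^sup>2\<close> into its negative. So the square equals its own conjugate, and the fourth power is the
  fourth power of the modulus. This replaces the evaluation of the sign of the Gauss sum.
\<close>

lemma gauss_sum_fourth_power:
  assumes "prime p" "odd p" "\<not> int p dvd u"
  shows "gauss_sum p u ^ 4 = (of_nat p)\<^sup>2"
proof -
  let ?R = "{0..<int p}"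
  have p: "p > 0" using assms(1) by (simp add: prime_gt_0_nat)
  obtain c d where cd: "[c\<^sup>2 + d\<^sup>2 = -1] (mod int p)"
    using minus_one_sum_two_squares assms by blast
  have sq: "(gauss_sum p v)\<^sup>2 = (\<Sum>(a, b)\<in>?R \<times> ?R. chi p (v * (a\<^sup>2 + b\<^sup>2)))" for v
    unfolding power2_eq_square[of "gauss_sum p v"] unfolding gauss_sum_def sum_product
    by (simp add: sum.cartesian_product distrib_left chi_add)
  define h where "h = (\<lambda>(a, b). ((c * a - d * b) mod int p, (d * a + c * b) mod int p))"
  \<comment> \<open>Multiplying by the conjugate \<open>c - d i\<close> recovers the pair up to the unit \<open>c\<^sup>2 + d\<^sup>2 = -1\<close>.\<close>
  have "inj_on h (?R \<times> ?R)"
  proof (rule inj_onI, clarify)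
    fix a b a' b'
    assume R: "a \<in> ?R" "b \<in> ?R" "a' \<in> ?R" "b' \<in> ?R" and eq: "h (a, b) = h (a', b')"
    have 1: "int p dvd (c * a - d * b) - (c * a' - d * b')"
      and 2: "int p dvd (d * a + c * b) - (d * a' + c * b')"
      using eq by (auto simp: h_def mod_eq_dvd_iff)
    have 3: "int p dvd c\<^sup>2 + d\<^sup>2 + 1" using cd by (simp add: cong_iff_dvd_diff)
    have "int p dvd (c\<^sup>2 + d\<^sup>2 + 1) * (a - a') - (c * ((c * a - d * b) - (c * a' - d * b'))
        + d * ((d * a + c * b) - (d * a' + c * b')))"
      by (rule dvd_diff[OF dvd_mult2[OF 3] dvd_add[OF dvd_mult[OF 1] dvd_mult[OF 2]]])
    then have "int p dvd a - a'" by (simp add: power2_eq_square algebra_simps)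
    moreover have "int p dvd (c\<^sup>2 + d\<^sup>2 + 1) * (b - b') - (c * ((d * a + c * b) - (d * a' + c * b'))
        - d * ((c * a - d * b) - (c * a' - d * b')))"
      by (rule dvd_diff[OF dvd_mult2[OF 3] dvd_diff[OF dvd_mult[OF 2] dvd_mult[OF 1]]])
    then have "int p dvd b - b'" by (simp add: power2_eq_square algebra_simps)
    ultimately show "a = a' \<and> b = b'" using R by (simp add: dvd_diff_residues_iff)
  qed
  moreover have "h ` (?R \<times> ?R) \<subseteq> ?R \<times> ?R" using p by (auto simp: h_def)
  ultimately have bij: "bij_betw h (?R \<times> ?R) (?R \<times> ?R)"
    by (simp add: bij_betw_def endo_inj_surj)
  have "(gauss_sum p u)\<^sup>2 = (\<Sum>x\<in>?R \<times> ?R. case h x of (a, b) \<Rightarrow> chi p (u * (a\<^sup>2 + b\<^sup>2)))"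
    unfolding sq by (rule sum.reindex_bij_betw[OF bij, symmetric])
  also have "\<dots> = (\<Sum>(a, b)\<in>?R \<times> ?R. chi p (- u * (a\<^sup>2 + b\<^sup>2)))"
  proof (intro sum.cong refl, clarify)
    fix a b
    have "[((c * a - d * b) mod int p)\<^sup>2 + ((d * a + c * b) mod int p)\<^sup>2
        = (c * a - d * b)\<^sup>2 + (d * a + c * b)\<^sup>2] (mod int p)"
      by (intro cong_add cong_pow) simp_all
    also have "(c * a - d * b)\<^sup>2 + (d * a + c * b)\<^sup>2 = (c\<^sup>2 + d\<^sup>2) * (a\<^sup>2 + b\<^sup>2)"
      by (simp add: power2_eq_square algebra_simps)
    also have "[(c\<^sup>2 + d\<^sup>2) * (a\<^sup>2 + b\<^sup>2) = - 1 * (a\<^sup>2 + b\<^sup>2)] (mod int p)"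
      by (intro cong_mult cd cong_refl)
    finally have "[u * (((c * a - d * b) mod int p)\<^sup>2 + ((d * a + c * b) mod int p)\<^sup>2)
        = u * (- 1 * (a\<^sup>2 + b\<^sup>2))] (mod int p)"
      by (intro cong_mult cong_refl)
    from chi_cong[OF p this]
    have "chi p (u * (((c * a - d * b) mod int p)\<^sup>2 + ((d * a + c * b) mod int p)\<^sup>2))
        = chi p (u * (- 1 * (a\<^sup>2 + b\<^sup>2)))" .
    also have "u * (- 1 * (a\<^sup>2 + b\<^sup>2)) = - u * (a\<^sup>2 + b\<^sup>2)" by (simp add: algebra_simps)
    finally show "(case h (a, b) of (a, b) \<Rightarrow> chi p (u * (a\<^sup>2 + b\<^sup>2))) = chi p (- u * (a\<^sup>2 + b\<^sup>2))"
      by (simp only: h_def prod.case)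
  qed
  also have "\<dots> = (cnj (gauss_sum p u))\<^sup>2" by (simp add: cnj_gauss_sum sq)
  finally have "(gauss_sum p u)\<^sup>2 = (cnj (gauss_sum p u))\<^sup>2" .
  then have "gauss_sum p u ^ 4 = (gauss_sum p u * cnj (gauss_sum p u))\<^sup>2"
    by (metis power2_eq_square power4_eq_xxxx power_mult_distrib mult.assoc)
  then show ?thesis using norm_gauss_sum[OF assms] by simp
qed

text \<open>Completing the square; the hypothesis says \<open>s = -1/(4u)\<close>, and the centre is \<open>2 s z = -z/(2u)\<close>.\<close>

lemma quadratic_exponential_sum:
  assumes "p > 0" "int p dvd 4 * s * u + 1"
  shows "(\<Sum>t\<in>{0..<int p}. chi p (u * t\<^sup>2 + z * t)) = chi p (s * z\<^sup>2) * gauss_sum p u"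
proof -
  have "gauss_sum p u = (\<Sum>t\<in>{0..<int p}. chi p (u * (t + (- 2 * s * z))\<^sup>2))"
    unfolding gauss_sum_def
    by (rule sum_residues_shift[OF assms(1), symmetric])
       (intro chi_cong assms(1) cong_mult cong_pow cong_refl)
  then have "chi p (s * z\<^sup>2) * gauss_sum p u
      = (\<Sum>t\<in>{0..<int p}. chi p (s * z\<^sup>2 + u * (t + (- 2 * s * z))\<^sup>2))"
    by (simp add: sum_distrib_left chi_add)
  also have "\<dots> = (\<Sum>t\<in>{0..<int p}. chi p (u * t\<^sup>2 + z * t))"
  proof (intro sum.cong refl chi_cong assms(1))
    fix t
    have "int p dvd (4 * s * u + 1) * (s * z\<^sup>2 - t * z)" using assms(2) by simp
    also have "(4 * s * u + 1) * (s * z\<^sup>2 - t * z)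
        = (s * z\<^sup>2 + u * (t + (- 2 * s * z))\<^sup>2) - (u * t\<^sup>2 + z * t)"
      by (simp add: power2_eq_square algebra_simps)
    finally show "[s * z\<^sup>2 + u * (t + (- 2 * s * z))\<^sup>2 = u * t\<^sup>2 + z * t] (mod int p)"
      by (simp add: cong_iff_dvd_diff)
  qed
  finally show ?thesis ..
qed

section \<open>Exponential sums over the four-dimensional space\<close>

text \<open>Product structure of the space, which reduces four-dimensional exponential sums to
  one-dimensional ones.\<close>

lemma Fp4_image: "Fp4 p = vec_lambda ` (PiE UNIV (\<lambda>_. {0..<int p}))"
proof (intro equalityI subsetI)
  fix x assume "x \<in> Fp4 p"
  then have "vec_nth x \<in> PiE UNIV (\<lambda>_. {0..<int p})" by (auto simp: Fp4_def PiE_iff)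
  moreover have "x = vec_lambda (vec_nth x)" by (rule vec_nth_inverse[symmetric])
  ultimately show "x \<in> vec_lambda ` (PiE UNIV (\<lambda>_. {0..<int p}))" by (metis (no_types) image_eqI)
next
  fix x :: "int ^ 4" assume "x \<in> vec_lambda ` (PiE UNIV (\<lambda>_. {0..<int p}))"
  then obtain f where f: "x = vec_lambda f" "f \<in> PiE UNIV (\<lambda>_. {0..<int p})" by (rule imageE)
  show "x \<in> Fp4 p" using PiE_mem[OF f(2)] by (simp add: Fp4_def f(1))
qed

lemma finite_Fp4 [simp]: "finite (Fp4 p)"
  unfolding Fp4_image by (intro finite_imageI finite_PiE) auto

lemma sum_Fp4_prod:
  fixes f :: "4 \<Rightarrow> int \<Rightarrow> complex"
  shows "(\<Sum>\<xi>\<in>Fp4 p. \<Prod>i\<in>UNIV. f i (\<xi> $ i)) = (\<Prod>i\<in>UNIV. \<Sum>t\<in>{0..<int p}. f i t)"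
proof -
  have "(\<Prod>i\<in>UNIV. \<Sum>t\<in>{0..<int p}. f i t)
      = (\<Sum>g\<in>PiE UNIV (\<lambda>_. {0..<int p}). \<Prod>i\<in>UNIV. f i (g i))"
    by (rule prod_sum_PiE) auto
  also have "\<dots> = (\<Sum>\<xi>\<in>Fp4 p. \<Prod>i\<in>UNIV. f i (\<xi> $ i))"
    unfolding Fp4_image by (subst sum.reindex) (auto intro!: inj_onI simp: vec_lambda_inject)
  finally show ?thesis ..
qed

lemma dot4_diff: "dot4 x (y - z) = dot4 x y - dot4 x z"
  by (simp add: dot4_def right_diff_distrib sum_subtractf)

lemma chi_Q4:
  assumes "p > 0" shows "chi p (u * Q4 p x) = chi p (u * (\<Sum>i\<in>UNIV. (x $ i)\<^sup>2))"
  by (intro chi_cong assms cong_mult cong_refl) (simp add: Q4_def cong_def)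

lemma Q4_minus_commute: "Q4 p (x - y) = Q4 p (y - x)"
  by (simp add: Q4_def power2_commute)

lemma Q4_residue: "p > 0 \<Longrightarrow> Q4 p x \<in> {0..<int p}"
  by (simp add: Q4_def)

lemma Fp4_orthogonality:
  assumes "p > 0" "x \<in> Fp4 p" "y \<in> Fp4 p"
  shows "(\<Sum>\<xi>\<in>Fp4 p. chi p (dot4 \<xi> (y - x))) = (if y = x then (of_nat p) ^ 4 else 0)"
proof -
  have "(\<Sum>\<xi>\<in>Fp4 p. chi p (dot4 \<xi> (y - x)))
      = (\<Prod>i\<in>UNIV. \<Sum>t\<in>{0..<int p}. chi p (t * (y $ i - x $ i)))"
    unfolding dot4_def by (simp add: chi_sum flip: sum_Fp4_prod)
  also have "\<dots> = (\<Prod>i\<in>(UNIV::4 set). if y $ i = x $ i then of_nat p else 0)"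
    using assms by (intro prod.cong refl)
      (simp add: chi_orthogonality dvd_diff_residues_iff Fp4_def del: atLeastLessThan_iff)
  also have "\<dots> = (if y = x then (of_nat p) ^ 4 else 0)"
    by (auto simp: vec_eq_iff)
  finally show ?thesis .
qed

text \<open>The key feature of dimension four: the constant in front is the same for all \<open>u\<close>, because it is the
  fourth power of a Gauss sum.\<close>

lemma quadratic_exponential_sum_Fp4:
  assumes "prime p" "odd p" "int p dvd 4 * s * u + 1"
  shows "(\<Sum>\<xi>\<in>Fp4 p. chi p (u * Q4 p \<xi> + dot4 \<xi> z)) = (of_nat p)\<^sup>2 * chi p (s * Q4 p z)"
proof -
  have p: "p > 0" using assms(1) by (simp add: prime_gt_0_nat)
  have u: "\<not> int p dvd u"
  proof
    assume "int p dvd u"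
    then have "int p dvd 1" using assms(3) by (metis dvd_add_right_iff dvd_mult)
    then show False using prime_gt_1_nat[OF assms(1)] by simp
  qed
  have "(\<Sum>\<xi>\<in>Fp4 p. chi p (u * Q4 p \<xi> + dot4 \<xi> z))
      = (\<Sum>\<xi>\<in>Fp4 p. \<Prod>i\<in>UNIV. chi p (u * (\<xi> $ i)\<^sup>2 + z $ i * \<xi> $ i))"
    by (simp add: chi_add chi_Q4[OF p] sum_distrib_left dot4_def chi_sum prod.distrib mult.commute)
  also have "\<dots> = (\<Prod>i\<in>UNIV. \<Sum>t\<in>{0..<int p}. chi p (u * t\<^sup>2 + z $ i * t))"
    by (rule sum_Fp4_prod)
  also have "\<dots> = (\<Prod>i\<in>(UNIV::4 set). chi p (s * (z $ i)\<^sup>2) * gauss_sum p u)"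
    by (simp add: quadratic_exponential_sum[OF p assms(3)])
  also have "\<dots> = (of_nat p)\<^sup>2 * chi p (s * Q4 p z)"
    by (simp add: prod.distrib gauss_sum_fourth_power[OF assms(1,2) u] chi_Q4[OF p] sum_distrib_left chi_sum)
  finally show ?thesis .
qed

lemma finite_Sph [simp]: "finite (Sph p j)"
  by (simp add: Sph_def)

lemma sum_Fp4_by_spheres:
  fixes g :: "int ^ 4 \<Rightarrow> 'a :: comm_monoid_add"
  assumes "p > 0"
  shows "(\<Sum>\<xi>\<in>Fp4 p. g \<xi>) = (\<Sum>j\<in>{0..<int p}. \<Sum>\<xi>\<in>Sph p j. g \<xi>)"
  unfolding Sph_def
  by (rule sum.group[symmetric]) (use Q4_residue[OF assms] in auto)

lemma mod_inverse_quarter: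
  assumes "prime p" "odd p" "\<not> int p dvd s"
  shows "\<exists>u\<in>{1..<int p}. int p dvd 4 * s * u + 1"
proof -
  have p: "p > 0" using assms(1) by (simp add: prime_gt_0_nat)
  have prime: "prime (int p)" using assms(1) by simp
  have "\<not> int p dvd 2 * (2 * s)"
    unfolding odd_prime_dvd_2_mult_iff[OF assms(1,2)] by (rule assms(3))
  then have "coprime (int p) (4 * s)"
    using prime_imp_coprime[OF prime, of "4 * s"] by (simp add: mult.assoc[symmetric])
  then have "coprime (4 * s) (int p)" by (rule coprime_commute[THEN iffD1])
  then obtain v where v: "[4 * s * v = 1] (mod int p)"
    using cong_solve_coprime_int by blast
  define u where "u = (- v) mod int p"
  have "[4 * s * u + 1 = 4 * s * (- v) + 1] (mod int p)"
    by (intro cong_add cong_mult cong_refl) (simp add: u_def)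
  also have "[4 * s * (- v) + 1 = 0] (mod int p)"
  proof -
    have "int p dvd - (4 * s * v - 1)" using v by (simp only: cong_iff_dvd_diff dvd_minus_iff)
    also have "- (4 * s * v - 1) = (4 * s * (- v) + 1) - 0" by simp
    finally show ?thesis by (simp only: cong_iff_dvd_diff)
  qed
  finally have *: "int p dvd 4 * s * u + 1" by (simp add: cong_0_iff)
  have "u \<noteq> 0"
  proof
    assume "u = 0"
    then have "int p dvd 1" using * by simp
    then show False using prime_gt_1_nat[OF assms(1)] by simp
  qed
  moreover have "0 \<le> u" "u < int p" using p by (simp_all add: u_def)
  ultimately have "u \<in> {1..<int p}" by simp
  then show ?thesis using * by blast
qed

lemma card_Fp4: "p > 0 \<Longrightarrow> card (Fp4 p) = p ^ 4"
proof -
  assume p: "p > 0"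
  have "(\<Sum>\<xi>\<in>Fp4 p. chi p (dot4 \<xi> (0 - 0))) = (of_nat p) ^ 4"
    using Fp4_orthogonality[OF p, of 0 0] p by (simp add: Fp4_def)
  then have "of_nat (card (Fp4 p)) = (of_nat (p ^ 4) :: complex)" by (simp add: dot4_def)
  then show ?thesis unfolding of_nat_eq_iff .
qed

text \<open>Detect \<open>Q4 p \<xi> = j\<close> by a sum of characters: the trivial frequency contributes \<open>p\<^sup>4\<close> and each of
  the others at most \<open>p\<^sup>2\<close>, to \<open>p\<close> times the cardinality.\<close>

lemma card_Sph_le:
  assumes "prime p" "odd p" "j \<in> {0..<int p}"
  shows "real (card (Sph p j)) \<le> 2 * real p ^ 3"
proof -
  let ?R = "{0..<int p}"
  have p: "p > 0" using assms(1) by (simp add: prime_gt_0_nat)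
  have p1: "p \<ge> 1" using p by simp
  have "(\<Sum>\<xi>\<in>Fp4 p. \<Sum>s\<in>?R. chi p (s * (Q4 p \<xi> - j))) = (\<Sum>\<xi>\<in>Fp4 p. if Q4 p \<xi> = j then of_nat p else 0)"
    using dvd_diff_residues_iff[OF Q4_residue[OF p] assms(3)]
    by (simp add: chi_orthogonality[OF p])
  also have "\<dots> = of_nat p * of_nat (card (Sph p j))"
    by (simp add: sum.If_cases Sph_def Int_def)
  finally have "of_nat p * of_nat (card (Sph p j)) = (\<Sum>s\<in>?R. \<Sum>\<xi>\<in>Fp4 p. chi p (s * (Q4 p \<xi> - j)))"
    by (simp add: sum.swap[of _ "Fp4 p"])
  then have "cmod (of_nat p * of_nat (card (Sph p j))) = cmod (\<Sum>s\<in>?R. \<Sum>\<xi>\<in>Fp4 p. chi p (s * (Q4 p \<xi> - j)))"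
    by simp
  also have "\<dots> \<le> (\<Sum>s\<in>?R. cmod (\<Sum>\<xi>\<in>Fp4 p. chi p (s * (Q4 p \<xi> - j))))"
    by (rule norm_sum)
  also have "\<dots> \<le> (\<Sum>s\<in>?R. if s = 0 then real p ^ 4 else (real p)\<^sup>2)"
  proof (rule sum_mono)
    fix s assume s: "s \<in> ?R"
    show "cmod (\<Sum>\<xi>\<in>Fp4 p. chi p (s * (Q4 p \<xi> - j))) \<le> (if s = 0 then real p ^ 4 else (real p)\<^sup>2)"
    proof (cases "s = 0")
      case True
      then show ?thesis using p by (simp add: card_Fp4 norm_power)
    next
      case False
      then have "\<not> int p dvd s" using s by (auto dest: zdvd_imp_le)
      then obtain u where "int p dvd 4 * s * u + 1" using mod_inverse_quarter assms by blast
      then have "int p dvd 4 * u * s + 1" by (simp add: mult_ac)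
      from quadratic_exponential_sum_Fp4[OF assms(1,2) this, of 0]
      have "(\<Sum>\<xi>\<in>Fp4 p. chi p (s * Q4 p \<xi>)) = (of_nat p)\<^sup>2" by (simp add: dot4_def Q4_def)
      then have "(\<Sum>\<xi>\<in>Fp4 p. chi p (s * (Q4 p \<xi> - j))) = (of_nat p)\<^sup>2 * cnj (chi p (s * j))"
        by (simp add: right_diff_distrib chi_diff flip: sum_distrib_right)
      then show ?thesis using False by (simp add: norm_mult norm_power)
    qed
  qed
  also have "\<dots> \<le> real p ^ 4 + real p * (real p)\<^sup>2"
  proof -
    have "?R = insert 0 {1..<int p}" using p by auto
    then have "(\<Sum>s\<in>?R. if s = 0 then real p ^ 4 else (real p)\<^sup>2) = real p ^ 4 + real (p - 1) * (real p)\<^sup>2"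
      by (simp add: nat_diff_distrib')
    also have "\<dots> \<le> real p ^ 4 + real p * (real p)\<^sup>2"
      by (intro add_left_mono mult_right_mono) auto
    finally show ?thesis .
  qed
  finally have "real p * real (card (Sph p j)) \<le> real p * (real p ^ 3 + (real p)\<^sup>2)"
    by (simp add: norm_mult power2_eq_square power3_eq_cube power4_eq_xxxx algebra_simps)
  moreover have "(real p)\<^sup>2 \<le> real p ^ 3" using p1 by (intro power_increasing) auto
  ultimately show ?thesis using p by simp
qed

section \<open>From pinned distances to Fourier transforms on spheres\<close>

definition dist_count :: "nat \<Rightarrow> (int ^ 4) set \<Rightarrow> int ^ 4 \<Rightarrow> int \<Rightarrow> nat" where
  "dist_count p E y t = card {x \<in> E. Q4 p (x - y) = t}"

definition ind_fourier :: "nat \<Rightarrow> (int ^ 4) set \<Rightarrow> int ^ 4 \<Rightarrow> complex" where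
  "ind_fourier p E \<xi> = (\<Sum>x\<in>E. chi p (- dot4 \<xi> x))"

text \<open>The frequencies in one sphere of the unnormalised Fourier expansion of the indicator of \<open>E\<close>: for
  \<open>y \<in> Fp4 p\<close>, the sum over all \<open>j\<close> is \<open>p ^ 4\<close> times the indicator at \<open>y\<close>.\<close>

definition sphere_part :: "nat \<Rightarrow> (int ^ 4) set \<Rightarrow> int \<Rightarrow> int ^ 4 \<Rightarrow> complex" where
  "sphere_part p E j y = (\<Sum>\<xi>\<in>Sph p j. ind_fourier p E \<xi> * chi p (dot4 \<xi> y))"

lemma zfourier_diff_const:
  assumes "p > 0"
  shows "zfourier p (\<lambda>t. f t - c) s = zfourier p f s - (if int p dvd s then of_nat p * c else 0)"
proof -
  have "zfourier p (\<lambda>t. f t - c) s = zfourier p f s - c * (\<Sum>t\<in>{0..<int p}. chi p (t * s))"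
    by (simp add: zfourier_def left_diff_distrib sum_subtractf sum_distrib_left mult.commute[of s])
  then show ?thesis by (simp add: chi_orthogonality[OF assms] mult.commute)
qed

lemma zfourier_dist_count:
  assumes "p > 0" "finite E"
  shows "zfourier p (\<lambda>t. of_nat (dist_count p E y t)) s = (\<Sum>x\<in>E. chi p (s * Q4 p (x - y)))"
proof -
  have "(\<Sum>x\<in>E. chi p (s * Q4 p (x - y)))
      = (\<Sum>t\<in>{0..<int p}. \<Sum>x\<in>{x \<in> E. Q4 p (x - y) = t}. chi p (s * Q4 p (x - y)))"
    using assms Q4_residue by (intro sum.group[symmetric]) auto
  also have "\<dots> = zfourier p (\<lambda>t. of_nat (dist_count p E y t)) s"
    by (simp add: zfourier_def dist_count_def)
  finally show ?thesis ..
qed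

text \<open>Summing over the radii against a character of the radius undoes the decomposition into spheres and
  leaves complete Gaussian sums over the whole space.\<close>

lemma zfourier_sphere_part:
  assumes "p > 0"
  shows "zfourier p (\<lambda>j. sphere_part p E j y) u
    = (\<Sum>x\<in>E. \<Sum>\<xi>\<in>Fp4 p. chi p (u * Q4 p \<xi> + dot4 \<xi> (y - x)))"
proof -
  have "zfourier p (\<lambda>j. sphere_part p E j y) u
      = (\<Sum>j\<in>{0..<int p}. \<Sum>\<xi>\<in>Sph p j. ind_fourier p E \<xi> * chi p (dot4 \<xi> y) * chi p (u * Q4 p \<xi>))"
    unfolding zfourier_def sphere_part_def sum_distrib_right
    by (intro sum.cong refl) (simp add: Sph_def)
  also have "\<dots> = (\<Sum>\<xi>\<in>Fp4 p. ind_fourier p E \<xi> * chi p (dot4 \<xi> y) * chi p (u * Q4 p \<xi>))"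
    by (rule sum_Fp4_by_spheres[OF assms, symmetric])
  also have "\<dots> = (\<Sum>\<xi>\<in>Fp4 p. \<Sum>x\<in>E. chi p (u * Q4 p \<xi> + dot4 \<xi> (y - x)))"
    unfolding ind_fourier_def sum_distrib_right
    by (intro sum.cong refl) (simp add: chi_add dot4_diff chi_diff cnj_chi mult_ac)
  finally show ?thesis by (simp add: sum.swap[of _ E])
qed

text \<open>
  The map \<open>s \<mapsto> -1/(4s)\<close> is an involution of the nonzero residues. So \<open>w\<close> and \<open>D\<close> have the same multiset
  of Fourier coefficients: their total energies agree by Parseval, and their values at 0 agree since these
  are the averages of the coefficients. Subtracting the term at 0 leaves the claim.
\<close>

lemma sphere_duality:
  assumes "prime p" "odd p"
    and "zfourier p w 0 = 0" "zfourier p D 0 = 0"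
    and dual: "\<And>s u. int p dvd 4 * s * u + 1 \<Longrightarrow> zfourier p w s = zfourier p D u"
  shows "(\<Sum>t\<in>{1..<int p}. (cmod (w t))\<^sup>2) = (\<Sum>j\<in>{1..<int p}. (cmod (D j))\<^sup>2)"
proof -
  let ?P = "{1..<int p}" and ?R = "{0..<int p}"
  have p: "p > 0" using assms(1) by (simp add: prime_gt_0_nat)
  have R: "?R = insert 0 ?P" using p by auto
  have nd: "\<not> int p dvd s" if "s \<in> ?P" for s using that by (auto dest: zdvd_imp_le)
  define h where "h = (\<lambda>s. SOME u. u \<in> ?P \<and> int p dvd 4 * s * u + 1)"
  have h: "h s \<in> ?P" "int p dvd 4 * s * h s + 1" if "s \<in> ?P" for s
  proof -
    have "\<exists>u. u \<in> ?P \<and> int p dvd 4 * s * u + 1"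
      using mod_inverse_quarter[OF assms(1,2) nd[OF that]] by blast
    from someI_ex[OF this] show "h s \<in> ?P" "int p dvd 4 * s * h s + 1" by (auto simp: h_def)
  qed
  have hh: "h (h s) = s" if "s \<in> ?P" for s
  proof -
    have "int p dvd (4 * h s * h (h s) + 1) * s - (4 * s * h s + 1) * h (h s)"
      using h[OF that] h[OF h(1)[OF that]] by (intro dvd_diff dvd_mult2)
    then have "int p dvd s - h (h s)" by (simp add: algebra_simps)
    then show ?thesis
      using dvd_diff_residues_iff[of s p "h (h s)"] that h(1)[OF h(1)[OF that]] by auto
  qed
  have reindex: "(\<Sum>s\<in>?P. g (zfourier p w s)) = (\<Sum>s\<in>?P. g (zfourier p D s))"
    for g :: "complex \<Rightarrow> 'b :: comm_monoid_add"
  proof (rule sum.reindex_bij_witness[where i = h and j = h])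
    fix s assume s: "s \<in> ?P"
    show "h (h s) = s" "h s \<in> ?P" by (fact hh[OF s], fact h(1)[OF s])
    then show "h (h s) = s" "h s \<in> ?P" by -
    show "g (zfourier p D (h s)) = g (zfourier p w s)" using dual[OF h(2)[OF s]] by simp
  qed
  have "of_nat p * w 0 = of_nat p * D 0"
    using reindex[of "\<lambda>z. z"] assms(3,4) by (simp add: R flip: sum_zfourier[OF p])
  then have "w 0 = D 0" using p by simp
  moreover have "real p * (\<Sum>t\<in>?R. (cmod (w t))\<^sup>2) = real p * (\<Sum>t\<in>?R. (cmod (D t))\<^sup>2)"
    unfolding parseval_residues[OF p, symmetric]
    using reindex[of "\<lambda>z. (cmod z)\<^sup>2"] assms(3,4) by (simp add: R)
  ultimately show ?thesis using p by (simp add: R)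
qed

text \<open>
  Both sides are \<open>sphere_duality\<close> for the counting function and the sphere parts, each with its mean
  removed. The mean of the sphere parts is where the indicator of \<open>E\<close> comes from: by orthogonality their
  sum over all \<open>j\<close> is \<open>p ^ 4\<close> or 0 according to whether \<open>y \<in> E\<close>.
\<close>

lemma distance_variance:
  assumes "prime p" "odd p" "E \<subseteq> Fp4 p" "y \<in> Fp4 p"
  shows "(\<Sum>t\<in>{1..<int p}. (real (dist_count p E y t) - real (card E) / real p)\<^sup>2)
    = (\<Sum>j\<in>{1..<int p}. (cmod (sphere_part p E j y / (of_nat p)\<^sup>2 - (if y \<in> E then of_nat p else 0)))\<^sup>2)"
proof -
  have p: "p > 0" using assms(1) by (simp add: prime_gt_0_nat)
  have E: "finite E" using assms(3) finite_subset finite_Fp4 by blast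
  define e :: complex where "e = (if y \<in> E then of_nat p else 0)"
  define w where "w = (\<lambda>t. of_nat (dist_count p E y t) - complex_of_real (real (card E) / real p))"
  define D where "D = (\<lambda>j. sphere_part p E j y / (of_nat p)\<^sup>2 - e)"
  have zD: "zfourier p D u = (\<Sum>x\<in>E. \<Sum>\<xi>\<in>Fp4 p. chi p (u * Q4 p \<xi> + dot4 \<xi> (y - x))) / (of_nat p)\<^sup>2
      - (if int p dvd u then of_nat p * e else 0)" for u
  proof -
    have "zfourier p (\<lambda>j. sphere_part p E j y / (of_nat p)\<^sup>2) u
        = zfourier p (\<lambda>j. sphere_part p E j y) u / (of_nat p)\<^sup>2"
      by (simp add: zfourier_def sum_divide_distrib)
    then show ?thesis unfolding D_def zfourier_diff_const[OF p] zfourier_sphere_part[OF p] by simp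
  qed
  have "zfourier p w 0 = 0"
    using p by (simp add: w_def zfourier_diff_const zfourier_dist_count E)
  moreover have "zfourier p D 0 = 0"
  proof -
    have "(\<Sum>x\<in>E. \<Sum>\<xi>\<in>Fp4 p. chi p (dot4 \<xi> (y - x))) = (\<Sum>x\<in>E. if y = x then (of_nat p) ^ 4 else 0)"
      using assms(3,4) by (intro sum.cong refl Fp4_orthogonality p) auto
    then show ?thesis
      using p E by (simp add: zD e_def power4_eq_xxxx power2_eq_square)
  qed
  moreover have "zfourier p w s = zfourier p D u" if su: "int p dvd 4 * s * u + 1" for s u
  proof -
    have "\<not> int p dvd s * u"
    proof
      assume "int p dvd s * u"
      then have "int p dvd 4 * s * u" by (simp add: mult.assoc)
      then have "int p dvd 1" using su by (simp add: dvd_add_right_iff)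
      then show False using prime_gt_1_nat[OF assms(1)] by simp
    qed
    then have "\<not> int p dvd s" "\<not> int p dvd u" by auto
    then show ?thesis
      using p by (simp add: zD w_def zfourier_diff_const zfourier_dist_count E
          quadratic_exponential_sum_Fp4[OF assms(1,2) su] Q4_minus_commute[of p y]
          flip: sum_distrib_left)
  qed
  ultimately have "(\<Sum>t\<in>{1..<int p}. (cmod (w t))\<^sup>2) = (\<Sum>j\<in>{1..<int p}. (cmod (D j))\<^sup>2)"
    by (rule sphere_duality[OF assms(1,2)])
  moreover have "cmod (w t) = \<bar>real (dist_count p E y t) - real (card E) / real p\<bar>" for t
    unfolding w_def by (metis norm_of_real of_real_diff of_real_of_nat_eq)
  ultimately show ?thesis by (simp add: D_def e_def)
qed

text \<open>The variance in units of the contribution \<open>(|E|/p)\<^sup>2\<close> of one missing distance.\<close>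

definition distance_defect :: "nat \<Rightarrow> (int ^ 4) set \<Rightarrow> int ^ 4 \<Rightarrow> real" where
  "distance_defect p E y = (real p)\<^sup>2 / (real (card E))\<^sup>2 *
     (\<Sum>t\<in>{1..<int p}. (real (dist_count p E y t) - real (card E) / real p)\<^sup>2)"

lemma missing_distances:
  assumes "p > 0" "finite E" "E \<noteq> {}"
  shows "real p - 1 - real (card (pinned_dists p y E)) \<le> distance_defect p E y"
proof -
  let ?P = "{1..<int p}" and ?D = "pinned_dists p y E"
  let ?c = "real (card E) / real p"
  have "real (card (?P - ?D)) * ?c\<^sup>2 = (\<Sum>t\<in>?P - ?D. ?c\<^sup>2)" by simp
  also have "\<dots> = (\<Sum>t\<in>?P - ?D. (real (dist_count p E y t) - ?c)\<^sup>2)"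
  proof (intro sum.cong refl)
    fix t assume "t \<in> ?P - ?D"
    then have "{x \<in> E. Q4 p (x - y) = t} = {}" by (auto simp: pinned_dists_def)
    then have "dist_count p E y t = 0" by (simp only: dist_count_def card.empty)
    then show "?c\<^sup>2 = (real (dist_count p E y t) - ?c)\<^sup>2" by simp
  qed
  also have "\<dots> \<le> (\<Sum>t\<in>?P. (real (dist_count p E y t) - ?c)\<^sup>2)"
    by (intro sum_mono2) auto
  finally have "real (card (?P - ?D)) \<le> (\<Sum>t\<in>?P. (real (dist_count p E y t) - ?c)\<^sup>2) / ?c\<^sup>2"
    using assms by (simp add: pos_le_divide_eq card_gt_0_iff)
  moreover have "card ?P - card ?D \<le> card (?P - ?D)"
    using assms(2) by (intro diff_card_le_card_Diff) (simp add: pinned_dists_def)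
  then have "real p - 1 - real (card ?D) \<le> real (card (?P - ?D))" using assms(1) by simp
  ultimately show ?thesis by (simp add: distance_defect_def power_divide mult.commute)
qed

section \<open>Extension estimates for spheres\<close>

lemma plancherel_ind_fourier:
  assumes "p > 0" "E \<subseteq> Fp4 p"
  shows "(\<Sum>\<xi>\<in>Fp4 p. (cmod (ind_fourier p E \<xi>))\<^sup>2) = real p ^ 4 * real (card E)"
proof -
  have E: "finite E" using assms(2) finite_subset finite_Fp4 by blast
  have "complex_of_real (\<Sum>\<xi>\<in>Fp4 p. (cmod (ind_fourier p E \<xi>))\<^sup>2)
      = (\<Sum>\<xi>\<in>Fp4 p. ind_fourier p E \<xi> * cnj (ind_fourier p E \<xi>))"
    by (simp add: complex_norm_square del: of_real_power)
  also have "\<dots> = (\<Sum>\<xi>\<in>Fp4 p. \<Sum>x\<in>E. \<Sum>x'\<in>E. chi p (dot4 \<xi> (x' - x)))"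
    unfolding ind_fourier_def cnj_sum sum_product
    by (intro sum.cong refl) (simp add: dot4_diff chi_diff cnj_chi mult.commute)
  also have "\<dots> = (\<Sum>x\<in>E. \<Sum>x'\<in>E. \<Sum>\<xi>\<in>Fp4 p. chi p (dot4 \<xi> (x' - x)))"
    by (rule trans[OF sum.swap], rule sum.cong, rule refl, rule sum.swap)
  also have "\<dots> = (\<Sum>x\<in>E. \<Sum>x'\<in>E. if x' = x then (of_nat p) ^ 4 else 0)"
    using assms(2) by (intro sum.cong refl Fp4_orthogonality assms(1)) auto
  also have "\<dots> = complex_of_real (real p ^ 4 * real (card E))"
    using E by simp
  finally show ?thesis unfolding of_real_eq_iff .
qed

text \<open>Membership of \<open>l\<close> in the set of exponents whose infimum is \<open>Lambda_sphere p j \<theta>\<close>.\<close>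

definition extension_bound :: "nat \<Rightarrow> int \<Rightarrow> real \<Rightarrow> real \<Rightarrow> bool" where
  "extension_bound p j \<theta> l \<longleftrightarrow> l \<ge> 0 \<and>
     (\<forall>E f. E \<subseteq> Fp4 p \<longrightarrow> 1 \<le> card E \<longrightarrow> real (card E) \<le> real p powr \<theta> \<longrightarrow>
        counting_L2_norm E (extension_op p j f) \<le> real p powr l * sphere_L2_norm p j f)"

lemma sphere_L2_norm_nonneg [simp]: "0 \<le> sphere_L2_norm p j f"
  by (simp add: sphere_L2_norm_def sum_nonneg)

lemma extension_bound_mono:
  assumes "extension_bound p j \<theta> l" "l \<le> l'" "p > 0"
  shows "extension_bound p j \<theta> l'"
  unfolding extension_bound_def
proof (intro conjI allI impI)
  show "0 \<le> l'" using assms(1,2) by (simp add: extension_bound_def)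
next
  fix E f assume "E \<subseteq> Fp4 p" "1 \<le> card E" "real (card E) \<le> real p powr \<theta>"
  then have "counting_L2_norm E (extension_op p j f) \<le> real p powr l * sphere_L2_norm p j f"
    using assms(1) by (simp add: extension_bound_def)
  also have "\<dots> \<le> real p powr l' * sphere_L2_norm p j f"
    using assms(2,3) by (intro mult_right_mono powr_mono) auto
  finally show "counting_L2_norm E (extension_op p j f) \<le> real p powr l' * sphere_L2_norm p j f" .
qed

lemma norm_extension_op_le: "cmod (extension_op p j f x) \<le> sphere_L2_norm p j f"
proof (cases "card (Sph p j) = 0")
  case True
  then show ?thesis by (simp add: extension_op_def)
next
  case False
  let ?n = "real (card (Sph p j))"
  have "cmod (extension_op p j f x) \<le> (\<Sum>y\<in>Sph p j. cmod (f y)) / ?n"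
    unfolding extension_op_def
    by (simp add: norm_mult norm_divide divide_right_mono sum_norm_le)
  also have "\<dots> \<le> sphere_L2_norm p j f"
    unfolding sphere_L2_norm_def
  proof (rule real_le_rsqrt)
    have "((\<Sum>y\<in>Sph p j. cmod (f y)) / ?n)\<^sup>2 = (\<Sum>y\<in>Sph p j. cmod (f y))\<^sup>2 / ?n\<^sup>2"
      by (rule power_divide)
    also have "\<dots> \<le> ((\<Sum>y\<in>Sph p j. (cmod (f y))\<^sup>2) * ?n) / ?n\<^sup>2"
      by (intro divide_right_mono sum_squared_le_sum_of_squares) simp
    also have "\<dots> = 1 / ?n * (\<Sum>\<xi>\<in>Sph p j. (cmod (f \<xi>))\<^sup>2)"
      using False by (simp add: power2_eq_square[of ?n])
    finally show "((\<Sum>y\<in>Sph p j. cmod (f y)) / ?n)\<^sup>2 \<le> 1 / ?n * (\<Sum>\<xi>\<in>Sph p j. (cmod (f \<xi>))\<^sup>2)" .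
  qed
  finally show ?thesis .
qed

text \<open>The infimum defining \<open>Lambda_sphere\<close> is taken over a nonempty set; without this fact its value would say
  nothing about the extension operator. The exponent comes from the pointwise bound above,
  added up over at most \<open>p powr \<theta>\<close> points.\<close>

lemma extension_bound_trivial:
  assumes "\<theta> \<ge> 0"
  shows "extension_bound p j \<theta> (\<theta> / 2)"
  unfolding extension_bound_def
proof (intro conjI allI impI)
  fix E :: "(int ^ 4) set" and f assume E: "real (card E) \<le> real p powr \<theta>"
  let ?s = "sphere_L2_norm p j f"
  have "(\<Sum>x\<in>E. (cmod (extension_op p j f x))\<^sup>2) \<le> (\<Sum>x\<in>E. ?s\<^sup>2)"
    by (intro sum_mono power_mono norm_extension_op_le) simp
  also have "\<dots> \<le> real p powr \<theta> * ?s\<^sup>2" using E by (simp add: mult_right_mono)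
  also have "real p powr \<theta> = (real p powr (\<theta> / 2))\<^sup>2"
    by (simp add: power2_eq_square flip: powr_add)
  also have "(real p powr (\<theta> / 2))\<^sup>2 * ?s\<^sup>2 = (real p powr (\<theta> / 2) * ?s)\<^sup>2"
    by (rule power_mult_distrib[symmetric])
  finally show "counting_L2_norm E (extension_op p j f) \<le> real p powr (\<theta> / 2) * ?s"
    unfolding counting_L2_norm_def by (intro real_le_lsqrt) simp_all
qed (use assms in simp)

text \<open>The sphere part is \<open>card (Sph p j)\<close> times the extension of the Fourier transform of \<open>E\<close>. Of the two
  factors \<open>card (Sph p j)\<close> in the squared norm, one cancels against the normalised \<open>L\<^sup>2\<close> norm on the sphere.\<close>

lemma sum_sphere_part_le:
  assumes "prime p" "odd p" "j \<in> {0..<int p}" "extension_bound p j \<theta> l"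
    and "F \<subseteq> Fp4 p" "1 \<le> card F" "real (card F) \<le> real p powr \<theta>"
  shows "(\<Sum>y\<in>F. (cmod (sphere_part p E j y))\<^sup>2)
    \<le> 2 * real p ^ 3 * real p powr (2 * l) * (\<Sum>\<xi>\<in>Sph p j. (cmod (ind_fourier p E \<xi>))\<^sup>2)"
proof -
  let ?f = "ind_fourier p E" and ?n = "real (card (Sph p j))"
  let ?S = "\<Sum>\<xi>\<in>Sph p j. (cmod (?f \<xi>))\<^sup>2"
  have powr2: "(real p powr l)\<^sup>2 = real p powr (2 * l)"
    by (metis mult_2 power2_eq_square powr_add)
  have S: "0 \<le> ?S" by (simp add: sum_nonneg)
  have norm2: "(sphere_L2_norm p j ?f)\<^sup>2 = 1 / ?n * ?S"
    unfolding sphere_L2_norm_def by (intro real_sqrt_pow2 mult_nonneg_nonneg S) simp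
  have eq: "sphere_part p E j y = of_nat (card (Sph p j)) * extension_op p j ?f y" for y
    by (cases "Sph p j = {}") (simp_all add: sphere_part_def extension_op_def)
  have "(\<Sum>y\<in>F. (cmod (sphere_part p E j y))\<^sup>2) = ?n\<^sup>2 * (counting_L2_norm F (extension_op p j ?f))\<^sup>2"
    by (simp add: eq counting_L2_norm_def norm_mult power_mult_distrib sum_nonneg sum_distrib_left)
  also have "\<dots> \<le> ?n\<^sup>2 * (real p powr l * sphere_L2_norm p j ?f)\<^sup>2"
    using assms(4-7) unfolding extension_bound_def
    by (intro mult_left_mono power_mono) (auto simp: counting_L2_norm_def sum_nonneg)
  also have "\<dots> = ?n\<^sup>2 * (real p powr (2 * l) * (1 / ?n * ?S))"
    by (simp only: power_mult_distrib powr2 norm2)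
  also have "\<dots> = ?n * (real p powr (2 * l) * ?S)"
    by (cases "?n = 0") (simp_all add: power2_eq_square[of ?n])
  also have "\<dots> \<le> (2 * real p ^ 3) * (real p powr (2 * l) * ?S)"
    by (intro mult_right_mono card_Sph_le assms(1-3) mult_nonneg_nonneg S) simp
  finally show ?thesis by (simp add: mult.assoc)
qed

lemma extension_bound_of_Lambda_sphere:
  assumes "p > 0" "\<theta> \<ge> 0" "Lambda_sphere p j \<theta> < l"
  shows "extension_bound p j \<theta> l"
proof -
  have "Lambda_sphere p j \<theta> = Inf {l. extension_bound p j \<theta> l}"
    by (simp add: Lambda_sphere_def extension_bound_def)
  moreover have "{l. extension_bound p j \<theta> l} \<noteq> {}"
    using extension_bound_trivial[OF assms(2)] by auto
  ultimately obtain l' where "extension_bound p j \<theta> l'" "l' < l"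
    using cInf_lessD[of "{l. extension_bound p j \<theta> l}" l] assms(3) by auto
  then show ?thesis using extension_bound_mono assms(1) by (meson less_imp_le)
qed

text \<open>Uniformity of the limit in \<open>\<theta>\<close> matters here: later the exponent \<open>\<theta>\<close> is the size of \<open>F\<close>, which may
  vary with \<open>p\<close>.\<close>

lemma eventually_extension_bound:
  assumes "localized_restriction_conjecture" "\<eta> > 0"
  shows "\<forall>\<^sub>F p in odd_primes_at_top. \<forall>\<theta>\<in>{0..4}. \<forall>j\<in>{1..<int p}. extension_bound p j \<theta> (Lambda_flat \<theta> + \<eta>)"
proof -
  have "\<forall>\<^sub>F p in odd_primes_at_top. prime p"
    by (simp add: odd_primes_at_top_def eventually_inf_principal)
  moreover have "\<forall>\<^sub>F p in odd_primes_at_top. \<forall>\<theta>\<in>{0..4}.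
      dist (SUP j\<in>{1..<int p}. Lambda_sphere p j \<theta>) (Lambda_flat \<theta>) < \<eta>"
    using assms unfolding localized_restriction_conjecture_def by (rule uniform_limitD)
  ultimately show ?thesis
  proof eventually_elim
    case (elim p)
    show ?case
    proof (intro ballI)
      fix \<theta> :: real and j assume \<theta>: "\<theta> \<in> {0..4}" and j: "j \<in> {1..<int p}"
      have "Lambda_sphere p j \<theta> \<le> (SUP j\<in>{1..<int p}. Lambda_sphere p j \<theta>)"
        by (intro cSUP_upper j bdd_above_finite) simp
      also have "\<dots> < Lambda_flat \<theta> + \<eta>"
        using elim(2) \<theta> by (force simp: dist_real_def)
      finally show "extension_bound p j \<theta> (Lambda_flat \<theta> + \<eta>)"
        using elim(1) \<theta> by (intro extension_bound_of_Lambda_sphere) (auto simp: prime_gt_0_nat)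
    qed
  qed
qed

section \<open>The average over the pins\<close>

lemma norm_diff_squared_le: "(cmod (a - b))\<^sup>2 \<le> 2 * (cmod a)\<^sup>2 + 2 * (cmod b)\<^sup>2"
proof -
  have "(cmod (a - b))\<^sup>2 \<le> (cmod a + cmod b)\<^sup>2"
    by (intro power_mono norm_triangle_ineq4) simp
  also have "\<dots> \<le> 2 * (cmod a)\<^sup>2 + 2 * (cmod b)\<^sup>2"
    using sum_squares_ge_zero[of "cmod a - cmod b" 0] by (simp add: power2_eq_square algebra_simps)
  finally show ?thesis .
qed

text \<open>
  The first term is the extension estimate summed over all spheres, where Plancherel replaces the sum of
  the energies on the spheres by \<open>p ^ 4 * |E|\<close>. The second comes from the constant \<open>p\<close> subtracted
  in \<open>distance_variance\<close> when \<open>y \<in> E\<close>, and is bounded as if this happened for every \<open>y \<in> F\<close>.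
\<close>

lemma sum_distance_defect_le:
  assumes "prime p" "odd p" "E \<subseteq> Fp4 p" "E \<noteq> {}"
    and "F \<subseteq> Fp4 p" "1 \<le> card F" "real (card F) \<le> real p powr \<theta>"
    and bound: "\<And>j. j \<in> {1..<int p} \<Longrightarrow> extension_bound p j \<theta> l"
  shows "(\<Sum>y\<in>F. distance_defect p E y)
    \<le> 4 * real p ^ 5 * real p powr (2 * l) / real (card E) + 2 * real p ^ 5 * real (card F) / (real (card E))\<^sup>2"
proof -
  have p: "p > 0" using assms(1) by (simp add: prime_gt_0_nat)
  have e: "real (card E) > 0" using assms(3,4) finite_subset[OF _ finite_Fp4] by (auto simp: card_gt_0_iff)
  let ?P = "{1..<int p}" and ?A = "\<lambda>j y. (cmod (sphere_part p E j y))\<^sup>2"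
  let ?V = "\<lambda>y. \<Sum>t\<in>?P. (real (dist_count p E y t) - real (card E) / real p)\<^sup>2"
  let ?S = "\<lambda>j. \<Sum>\<xi>\<in>Sph p j. (cmod (ind_fourier p E \<xi>))\<^sup>2"
  have V: "?V y \<le> 2 / real p ^ 4 * (\<Sum>j\<in>?P. ?A j y) + 2 * real p ^ 3" if "y \<in> F" for y
  proof -
    have "?V y = (\<Sum>j\<in>?P. (cmod (sphere_part p E j y / (of_nat p)\<^sup>2 - (if y \<in> E then of_nat p else 0)))\<^sup>2)"
      using that assms(5) by (intro distance_variance assms(1-3)) auto
    also have "\<dots> \<le> (\<Sum>j\<in>?P. 2 / real p ^ 4 * ?A j y + 2 * (real p)\<^sup>2)"
    proof (rule sum_mono)
      fix j
      let ?a = "sphere_part p E j y / (of_nat p)\<^sup>2" and ?b = "if y \<in> E then of_nat p else 0 :: complex"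
      have "(cmod (?a - ?b))\<^sup>2 \<le> 2 * (cmod ?a)\<^sup>2 + 2 * (cmod ?b)\<^sup>2" by (rule norm_diff_squared_le)
      also have "(cmod ?a)\<^sup>2 = ?A j y / real p ^ 4"
        by (simp add: norm_divide norm_power power_divide flip: power_mult)
      also have "(cmod ?b)\<^sup>2 \<le> (real p)\<^sup>2" by simp
      finally show "(cmod (?a - ?b))\<^sup>2 \<le> 2 / real p ^ 4 * ?A j y + 2 * (real p)\<^sup>2" by simp
    qed
    also have "\<dots> = 2 / real p ^ 4 * (\<Sum>j\<in>?P. ?A j y) + real (p - 1) * (2 * (real p)\<^sup>2)"
      using p by (simp add: sum.distrib sum_distrib_left nat_diff_distrib')
    also have "\<dots> \<le> 2 / real p ^ 4 * (\<Sum>j\<in>?P. ?A j y) + real p * (2 * (real p)\<^sup>2)"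
      by (intro add_left_mono mult_right_mono) auto
    finally show ?thesis by (simp add: power2_eq_square power3_eq_cube)
  qed
  have "(\<Sum>y\<in>F. \<Sum>j\<in>?P. ?A j y) = (\<Sum>j\<in>?P. \<Sum>y\<in>F. ?A j y)" by (rule sum.swap)
  also have "\<dots> \<le> (\<Sum>j\<in>?P. 2 * real p ^ 3 * real p powr (2 * l) * ?S j)"
    by (intro sum_mono sum_sphere_part_le[where \<theta> = \<theta>] assms bound) auto
  also have "\<dots> \<le> 2 * real p ^ 3 * real p powr (2 * l) * (\<Sum>j\<in>{0..<int p}. ?S j)"
    unfolding sum_distrib_left[symmetric]
    by (intro mult_left_mono sum_mono2) (auto intro: sum_nonneg)
  also have "(\<Sum>j\<in>{0..<int p}. ?S j) = real p ^ 4 * real (card E)"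
    using sum_Fp4_by_spheres[OF p, of "\<lambda>\<xi>. (cmod (ind_fourier p E \<xi>))\<^sup>2"]
      plancherel_ind_fourier[OF p assms(3)] by simp
  finally have A: "(\<Sum>y\<in>F. \<Sum>j\<in>?P. ?A j y)
      \<le> 2 * real p ^ 3 * real p powr (2 * l) * (real p ^ 4 * real (card E))" .
  have "(\<Sum>y\<in>F. ?V y) \<le> (\<Sum>y\<in>F. 2 / real p ^ 4 * (\<Sum>j\<in>?P. ?A j y) + 2 * real p ^ 3)"
    by (intro sum_mono V)
  also have "\<dots> = 2 / real p ^ 4 * (\<Sum>y\<in>F. \<Sum>j\<in>?P. ?A j y) + 2 * real p ^ 3 * real (card F)"
    by (simp add: sum.distrib sum_distrib_left)
  also have "\<dots> \<le> 2 / real p ^ 4 * (2 * real p ^ 3 * real p powr (2 * l) * (real p ^ 4 * real (card E)))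
      + 2 * real p ^ 3 * real (card F)"
    by (intro add_right_mono mult_left_mono A) simp
  also have "\<dots> = 4 * real p ^ 3 * real p powr (2 * l) * real (card E) + 2 * real p ^ 3 * real (card F)"
    using p by (simp add: field_simps)
  finally have V_sum: "(\<Sum>y\<in>F. ?V y)
      \<le> 4 * real p ^ 3 * real p powr (2 * l) * real (card E) + 2 * real p ^ 3 * real (card F)" .
  have "(\<Sum>y\<in>F. distance_defect p E y) = (real p)\<^sup>2 / (real (card E))\<^sup>2 * (\<Sum>y\<in>F. ?V y)"
    by (simp add: distance_defect_def sum_distrib_left)
  also have "\<dots> \<le> (real p)\<^sup>2 / (real (card E))\<^sup>2 *
      (4 * real p ^ 3 * real p powr (2 * l) * real (card E) + 2 * real p ^ 3 * real (card F))"
    by (intro mult_left_mono V_sum) simp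
  also have "\<dots> = 4 * real p ^ 5 * real p powr (2 * l) / real (card E)
      + 2 * real p ^ 5 * real (card F) / (real (card E))\<^sup>2"
    using e by (simp add: field_simps eval_nat_numeral)
  finally show ?thesis .
qed

text \<open>
  Here \<open>|E| = p powr a\<close> and \<open>|F| = p powr \<theta>\<close>, and the claim is that \<open>4 + 2 \<Lambda>(\<theta>) + \<epsilon>/4 \<le> a + \<theta>\<close>. For
  \<open>\<theta> < 2\<close> this is part of the hypothesis; for \<open>2 \<le> \<theta> \<le> 3\<close> it says \<open>a \<ge> 2 + \<epsilon>/4\<close>, true as \<open>a\<close> is at
  least half of \<open>a + \<theta>\<close>; for \<open>\<theta> > 3\<close> it says \<open>5 + \<epsilon>/4 \<le> a + \<theta>\<close>, true as \<open>a + \<theta>\<close> is larger than 6 and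
  at least \<open>4 + \<epsilon>\<close>.
\<close>

lemma exponent_balance:
  fixes a \<theta> \<epsilon> :: real
  assumes "\<epsilon> > 0" "\<theta> \<le> a" "4 + \<epsilon> \<le> a + \<theta>"
  shows "5 + 2 * (Lambda_flat \<theta> + \<epsilon> / 16) - a \<le> 1 - \<epsilon> / 8 + \<theta>"
  using assms by (simp add: Lambda_flat_def field_simps)

lemma average_defect_le:
  assumes p: "prime p" "odd p" and E: "E \<subseteq> Fp4 p" and F: "F \<subseteq> Fp4 p"
    and FE: "card F \<le> card E"
    and large: "real (card E) * real (card F) \<ge> real p powr (4 + \<epsilon>)" and "\<epsilon> > 0"
    and bound: "\<And>\<theta> j. \<theta> \<in> {0..4} \<Longrightarrow> j \<in> {1..<int p} \<Longrightarrow> extension_bound p j \<theta> (Lambda_flat \<theta> + \<epsilon> / 16)"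
  shows "(\<Sum>y\<in>F. distance_defect p E y) \<le> 6 * real p powr (1 - \<epsilon> / 8) * real (card F)"
proof -
  have p1: "real p > 1" using prime_gt_1_nat[OF p(1)] by simp
  have "0 < real p powr (4 + \<epsilon>)" using p1 by simp
  then have "real (card E) * real (card F) > 0" using large by linarith
  then have e0: "card E > 0" and f0: "card F > 0" by (auto simp: zero_less_mult_iff)
  define a where "a = log p (card E)"
  define \<theta> where "\<theta> = log p (card F)"
  have e: "real (card E) = real p powr a" using e0 p1 by (simp add: a_def)
  have f: "real (card F) = real p powr \<theta>" using f0 p1 by (simp add: \<theta>_def)
  have "real (card F) \<le> real p powr 4"
    using card_mono[OF finite_Fp4 F] card_Fp4[of p] p1 by (simp flip: of_nat_power)
  then have "\<theta> \<le> 4" unfolding f by (simp only: powr_le_cancel_iff[OF p1])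
  moreover have "\<theta> \<ge> 0" using f0 p1 by (simp add: \<theta>_def)
  ultimately have \<theta>: "\<theta> \<in> {0..4}" by simp
  have \<theta>a: "\<theta> \<le> a" using FE f0 p1 by (simp add: a_def \<theta>_def)
  have sum: "4 + \<epsilon> \<le> a + \<theta>" using large p1 by (simp add: e f flip: powr_add)
  have p5: "real p ^ 5 = real p powr 5" using p1 by simp
  have e2: "(real p powr a)\<^sup>2 = real p powr (2 * a)" by (metis mult_2 power2_eq_square powr_add)
  have "(\<Sum>y\<in>F. distance_defect p E y)
      \<le> 4 * real p ^ 5 * real p powr (2 * (Lambda_flat \<theta> + \<epsilon> / 16)) / real (card E)
        + 2 * real p ^ 5 * real (card F) / (real (card E))\<^sup>2"
    using e0 f0 by (intro sum_distance_defect_le[OF p E _ F _ _ bound[OF \<theta>]]) (auto simp: f)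
  also have "\<dots> = 4 * real p powr (5 + 2 * (Lambda_flat \<theta> + \<epsilon> / 16) - a) + 2 * real p powr (5 + \<theta> - 2 * a)"
    by (simp add: e f p5 e2 powr_add powr_diff del: powr_numeral)
  also have "\<dots> \<le> 4 * real p powr (1 - \<epsilon> / 8 + \<theta>) + 2 * real p powr (1 - \<epsilon> / 8 + \<theta>)"
  proof -
    have "5 + \<theta> - 2 * a \<le> 1 - \<epsilon> / 8 + \<theta>" using \<theta>a sum \<open>\<epsilon> > 0\<close> by simp
    then have "real p powr (5 + \<theta> - 2 * a) \<le> real p powr (1 - \<epsilon> / 8 + \<theta>)"
      by (rule powr_mono) (use p1 in simp)
    moreover have "real p powr (5 + 2 * (Lambda_flat \<theta> + \<epsilon> / 16) - a) \<le> real p powr (1 - \<epsilon> / 8 + \<theta>)"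
      by (rule powr_mono[OF exponent_balance[OF \<open>\<epsilon> > 0\<close> \<theta>a sum]]) (use p1 in simp)
    ultimately show ?thesis by linarith
  qed
  also have "\<dots> = 6 * real p powr (1 - \<epsilon> / 8) * real (card F)"
    by (simp add: f powr_add)
  finally show ?thesis .
qed

section \<open>Many distances from most pins\<close>

lemma tendsto_powr_odd_primes:
  assumes "s < 0"
  shows "((\<lambda>p. real p powr s) \<longlongrightarrow> 0) odd_primes_at_top"
proof -
  have "((\<lambda>p. real p powr s) \<longlongrightarrow> 0) at_top"
    using assms by (intro tendsto_neg_powr filterlim_real_sequentially) auto
  then show ?thesis unfolding odd_primes_at_top_def by (rule tendsto_mono[rotated]) simp
qed

lemma card_pinned_dists_le:
  assumes "p > 0" shows "card (pinned_dists p y E) \<le> p"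
proof -
  have "pinned_dists p y E \<subseteq> {0..<int p}"
    using Q4_residue[OF assms] by (auto simp: pinned_dists_def)
  from card_mono[OF _ this] show ?thesis by simp
qed

lemma markov_inequality_card:
  fixes D :: "'a \<Rightarrow> real"
  assumes "finite F" "\<And>y. y \<in> F \<Longrightarrow> 0 \<le> D y" "c > 0"
  shows "c * real (card {y \<in> F. c < D y}) \<le> (\<Sum>y\<in>F. D y)"
proof -
  have "c * real (card {y \<in> F. c < D y}) = (\<Sum>y\<in>{y \<in> F. c < D y}. c)" by simp
  also have "\<dots> \<le> (\<Sum>y\<in>{y \<in> F. c < D y}. D y)" by (intro sum_mono) auto
  also have "\<dots> \<le> (\<Sum>y\<in>F. D y)" using assms by (intro sum_mono2) auto
  finally show ?thesis .
qed

text \<open>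
  The average defect is at most \<open>6 * p powr (1 - \<epsilon>/8)\<close>. Cutting at \<open>c = p powr (1 - \<epsilon>/16)\<close> splits the gain
  evenly between the proportion of discarded pins and the proportion of distances missed by a kept pin; the
  additional \<open>1/p\<close> accounts for the distance 0.
\<close>

lemma many_pins:
  assumes p: "prime p" "odd p" and E: "E \<subseteq> Fp4 p" and F: "F \<subseteq> Fp4 p"
    and FE: "card F \<le> card E"
    and large: "real (card E) * real (card F) \<ge> real p powr (4 + \<epsilon>)" and "\<epsilon> > 0"
    and bound: "\<And>\<theta> j. \<theta> \<in> {0..4} \<Longrightarrow> j \<in> {1..<int p} \<Longrightarrow> extension_bound p j \<theta> (Lambda_flat \<theta> + \<epsilon> / 16)"
  shows "\<exists>F' \<subseteq> F. \<bar>real (card F') - real (card F)\<bar> \<le> 6 * real p powr (- \<epsilon> / 16) * real (card F) \<and>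
    (\<forall>y\<in>F'. \<bar>real (card (pinned_dists p y E)) - real p\<bar>
       \<le> (real p powr (- \<epsilon> / 16) + real p powr (- 1)) * real p)"
proof -
  have p0: "p > 0" using p(1) by (simp add: prime_gt_0_nat)
  define c where "c = real p powr (1 - \<epsilon> / 16)"
  have c0: "c > 0" using p0 by (simp add: c_def)
  have finF: "finite F" and finE: "finite E" using E F finite_subset[OF _ finite_Fp4] by auto
  have "E \<noteq> {}" using large p0 by auto
  define B where "B = {y \<in> F. c < distance_defect p E y}"
  have "c * real (card B) \<le> (\<Sum>y\<in>F. distance_defect p E y)"
    unfolding B_def by (intro markov_inequality_card finF c0) (simp add: distance_defect_def sum_nonneg)
  also have "\<dots> \<le> 6 * real p powr (1 - \<epsilon> / 8) * real (card F)"
    using average_defect_le[OF p E F FE large \<open>\<epsilon> > 0\<close> bound] .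
  also have "\<dots> = c * (6 * real p powr (- \<epsilon> / 16) * real (card F))"
    using p0 by (simp add: c_def flip: powr_add)
  finally have B: "real (card B) \<le> 6 * real p powr (- \<epsilon> / 16) * real (card F)"
    using c0 by simp
  show ?thesis
  proof (intro exI[of _ "F - B"] conjI ballI)
    have "B \<subseteq> F" by (auto simp: B_def)
    then have "real (card (F - B)) = real (card F) - real (card B)"
      using finF by (simp add: card_Diff_subset finite_subset card_mono)
    then show "\<bar>real (card (F - B)) - real (card F)\<bar> \<le> 6 * real p powr (- \<epsilon> / 16) * real (card F)"
      using B by simp
  next
    fix y assume "y \<in> F - B"
    then have "real p - 1 - real (card (pinned_dists p y E)) \<le> c"
      using missing_distances[OF p0 finE \<open>E \<noteq> {}\<close>, of y] by (auto simp: B_def)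
    moreover have "real p * real p powr (- \<epsilon> / 16) = c" "real p * real p powr (- 1) = 1"
      using p0 powr_mult_base[of "real p" "- \<epsilon> / 16"] powr_mult_base[of "real p" "- 1"]
      by (simp_all add: c_def)
    then have "(real p powr (- \<epsilon> / 16) + real p powr (- 1)) * real p = c + 1"
      by (metis distrib_left mult.commute)
    ultimately show "\<bar>real (card (pinned_dists p y E)) - real p\<bar>
        \<le> (real p powr (- \<epsilon> / 16) + real p powr (- 1)) * real p"
      using card_pinned_dists_le[OF p0, of y E] by simp
  qed auto
qed

theorem corollary1p8:
  fixes \<epsilon> :: real
  assumes "localized_restriction_conjecture"
    and "\<epsilon> > 0"
  shows "\<exists>\<delta>1 \<delta>2 :: nat \<Rightarrow> real.
    (\<delta>1 \<longlongrightarrow> 0) odd_primes_at_top \<and> (\<delta>2 \<longlongrightarrow> 0) odd_primes_at_top \<and>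
    (\<forall>p E F. prime p \<longrightarrow> odd p \<longrightarrow> E \<subseteq> Fp4 p \<longrightarrow> F \<subseteq> Fp4 p \<longrightarrow>
       card F \<le> card E \<longrightarrow> real (card E) * real (card F) \<ge> real p powr (4 + \<epsilon>) \<longrightarrow>
       (\<exists>F' \<subseteq> F. \<bar>real (card F') - real (card F)\<bar> \<le> \<delta>1 p * real (card F) \<and>
          (\<forall>y\<in>F'. \<bar>real (card (pinned_dists p y E)) - real p\<bar> \<le> \<delta>2 p * real p)))"
proof -
  define good where "good = (\<lambda>p. \<forall>\<theta>\<in>{0..4}. \<forall>j\<in>{1..<int p}. extension_bound p j \<theta> (Lambda_flat \<theta> + \<epsilon> / 16))"
  \<comment> \<open>At the primes where the bounds are not yet available, \<open>F' = {}\<close> with error rate 1 will do.\<close>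
  define \<delta>1 where "\<delta>1 = (\<lambda>p. if good p then 6 * real p powr (- \<epsilon> / 16) else 1)"
  define \<delta>2 where "\<delta>2 = (\<lambda>p. if good p then real p powr (- \<epsilon> / 16) + real p powr (- 1) else 1)"
  have good: "eventually good odd_primes_at_top"
    using eventually_extension_bound[OF assms(1), of "\<epsilon> / 16"] assms(2) by (simp add: good_def)
  have "((\<lambda>p. 6 * real p powr (- \<epsilon> / 16)) \<longlongrightarrow> 6 * 0) odd_primes_at_top"
    using assms(2) by (intro tendsto_intros tendsto_powr_odd_primes) simp
  then have "((\<lambda>p. 6 * real p powr (- \<epsilon> / 16)) \<longlongrightarrow> 0) odd_primes_at_top" by simp
  then have 1: "(\<delta>1 \<longlongrightarrow> 0) odd_primes_at_top"
    by (rule Lim_transform_eventually) (use good in eventually_elim, simp add: \<delta>1_def)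
  have "((\<lambda>p. real p powr (- \<epsilon> / 16) + real p powr (- 1)) \<longlongrightarrow> 0 + 0) odd_primes_at_top"
    using assms(2) by (intro tendsto_add tendsto_powr_odd_primes) simp_all
  then have "((\<lambda>p. real p powr (- \<epsilon> / 16) + real p powr (- 1)) \<longlongrightarrow> 0) odd_primes_at_top" by simp
  then have 2: "(\<delta>2 \<longlongrightarrow> 0) odd_primes_at_top"
    by (rule Lim_transform_eventually) (use good in eventually_elim, simp add: \<delta>2_def)
  have 3: "\<exists>F' \<subseteq> F. \<bar>real (card F') - real (card F)\<bar> \<le> \<delta>1 p * real (card F) \<and>
      (\<forall>y\<in>F'. \<bar>real (card (pinned_dists p y E)) - real p\<bar> \<le> \<delta>2 p * real p)"
    if "prime p" "odd p" "E \<subseteq> Fp4 p" "F \<subseteq> Fp4 p" "card F \<le> card E"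
      "real (card E) * real (card F) \<ge> real p powr (4 + \<epsilon>)" for p E F
  proof (cases "good p")
    case True
    then show ?thesis using many_pins[OF that assms(2)] by (simp add: \<delta>1_def \<delta>2_def good_def)
  next
    case False
    then show ?thesis by (intro exI[of _ "{}"]) (simp add: \<delta>1_def)
  qed
  show ?thesis
  proof (rule exI[of _ \<delta>1], rule exI[of _ \<delta>2], intro conjI allI impI)
  qed (fact 1, fact 2, rule 3)
qed

end
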